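(* Let $n\ge 1$ and $r\ge 1$ be integers and let $I_{r,n}$ be the number of inversions of the permutation obtained after $r$ iterated random-to-top shuffles of an $n$-card deck, starting from the identity. Then $$\mathbb{E}[I_{r,n}]=\frac{\binom{n}{2}}{2}\left(1-\left(\frac{n-2}{n}\right)^r\right).$$
   Context: A deck of $n$ cards labelled $1,\dots,n$ in some order is encoded by the permutation $\sigma$ of $[n]=\{1,\dots,n\}$ where $\sigma(i)$ is the card in position $i$ (position $1$ is the top). A random-to-top shuffle selects one of the $n$ cards uniformly at random (the top card may be selected) and moves it to the top, keeping the relative order of the other cards. Iterated random-to-top shuffles start from the deck in order $12\cdots n$ and perform the selections independently. An inversion of $\sigma$ is a pair $(i,j)$ with $1\le i<j\le n$ and $\sigma(i)>\sigma(j)$. *)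

theory Defs
  imports "HOL-Probability.Probability" "HOL-Combinatorics.Permutations"
begin

(* A deck of n cards is a function \<sigma> with "\<sigma> permutes {1..n}"; \<sigma> i is the card in position i,
   so card c sits in position inv \<sigma> c. Moving c to the top shifts the cards in positions
   1, ..., inv \<sigma> c - 1 down by one and leaves the cards below c where they are.
   Position 0 lies outside the deck and is fixed, because inv \<sigma> c \<ge> 1 for c in {1..n}. *)
definition move_to_top :: "nat \<Rightarrow> (nat \<Rightarrow> nat) \<Rightarrow> nat \<Rightarrow> nat" where
  "move_to_top c \<sigma> i =
     (if i = 1 then c
      else if 2 \<le> i \<and> i \<le> inv \<sigma> c then \<sigma> (i - 1)
      else \<sigma> i)"

definition random_to_top :: "nat \<Rightarrow> (nat \<Rightarrow> nat) \<Rightarrow> (nat \<Rightarrow> nat) pmf" where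
  "random_to_top n \<sigma> = map_pmf (\<lambda>c. move_to_top c \<sigma>) (pmf_of_set {1..n})"

primrec iterated_random_to_top :: "nat \<Rightarrow> nat \<Rightarrow> (nat \<Rightarrow> nat) pmf" where
  "iterated_random_to_top n 0 = return_pmf id"
| "iterated_random_to_top n (Suc r) = bind_pmf (iterated_random_to_top n r) (random_to_top n)"

definition inversions :: "nat \<Rightarrow> (nat \<Rightarrow> nat) \<Rightarrow> nat" where
  "inversions n \<sigma> = card {(i, j). 1 \<le> i \<and> i < j \<and> j \<le> n \<and> \<sigma> i > \<sigma> j}"

end

(* Count inversions by pairs of cards a < b with b above a. Moving card c to the top makes such a
   pair inverted if c = b, not inverted if c = a, and leaves it unchanged otherwise. Summing over c,
   one shuffle sends the expected number e of inversions to ((n choose 2) + (n - 2) e) / n, and this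
   affine map has fixed point (n choose 2) / 2. *)
theory Submission
  imports Defs
begin

text \<open>The entries are card labels, not positions, so the index set is the same for every deck
  and the sum over pairs can be exchanged with the sum over the moved card.\<close>

definition card_pairs :: "nat \<Rightarrow> (nat \<times> nat) set" where
  "card_pairs n = {(a, b). 1 \<le> a \<and> a < b \<and> b \<le> n}"

lemma finite_card_pairs: "finite (card_pairs n)"
  by (rule finite_subset[of _ "{1..n} \<times> {1..n}"]) (auto simp: card_pairs_def)

lemma card_card_pairs: "card (card_pairs n) = n choose 2"
proof (induction n)
  case 0
  have "card_pairs 0 = {}"
    by (auto simp: card_pairs_def)
  then show ?case by simp
next
  case (Suc n)
  have "card_pairs (Suc n) = card_pairs n \<union> (\<lambda>a. (a, Suc n)) ` {1..n}"
    by (auto simp: card_pairs_def)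
  moreover have "card_pairs n \<inter> (\<lambda>a. (a, Suc n)) ` {1..n} = {}"
    by (auto simp: card_pairs_def)
  moreover have "card ((\<lambda>a. (a, Suc n)) ` {1..n}) = n"
    by (subst card_image) (auto intro: inj_onI)
  ultimately show ?case
    using Suc by (simp add: card_Un_disjoint finite_card_pairs numeral_2_eq_2)
qed

lemma inversions_eq_sum_card_pairs:
  assumes "\<sigma> permutes {1..n}"
  shows "real (inversions n \<sigma>) = (\<Sum>(a, b)\<in>card_pairs n. of_bool (inv \<sigma> b < inv \<sigma> a))"
proof -
  note inverses = permutes_inverses[OF assms]
  have range: "\<sigma> i \<in> {1..n} \<longleftrightarrow> i \<in> {1..n}" "inv \<sigma> i \<in> {1..n} \<longleftrightarrow> i \<in> {1..n}" for i
    using permutes_in_image[OF assms] permutes_in_image[OF permutes_inv[OF assms]] by auto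
  let ?A = "{(i, j). 1 \<le> i \<and> i < j \<and> j \<le> n \<and> \<sigma> i > \<sigma> j}"
  let ?B = "{(a, b) \<in> card_pairs n. inv \<sigma> b < inv \<sigma> a}"
  \<comment> \<open>The coordinates swap: at an inversion the smaller card \<open>\<sigma> j\<close>
    is the lower one in the deck.\<close>
  have "bij_betw (\<lambda>(i, j). (\<sigma> j, \<sigma> i)) ?A ?B"
    by (rule bij_betw_byWitness[where f' = "\<lambda>(a, b). (inv \<sigma> b, inv \<sigma> a)"])
       (use range in \<open>fastforce simp: card_pairs_def inverses\<close>)+
  then have "inversions n \<sigma> = card ?B"
    unfolding inversions_def by (rule bij_betw_same_card)
  moreover have "?B = {p \<in> card_pairs n. inv \<sigma> (snd p) < inv \<sigma> (fst p)}"
    by auto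
  ultimately show ?thesis
    using finite_card_pairs by (simp add: of_bool_def sum.If_cases case_prod_unfold Int_def)
qed

text \<open>Both claims follow once \<open>?g\<close> is checked to be a two-sided inverse. The
  guard \<open>1 \<le> inv \<sigma> d\<close> keeps label 0, which sits at position 0, from being
  shifted into the deck.\<close>

lemma
  assumes perm: "\<sigma> permutes {1..n}" and c: "c \<in> {1..n}"
  shows permutes_move_to_top: "move_to_top c \<sigma> permutes {1..n}"
    and inv_move_to_top: "inv (move_to_top c \<sigma>) =
      (\<lambda>d. if d = c then 1 else if 1 \<le> inv \<sigma> d \<and> inv \<sigma> d < inv \<sigma> c then inv \<sigma> d + 1 else inv \<sigma> d)"
      (is "_ = ?g")
proof -
  note inverses = permutes_inverses[OF perm]
  have range: "inv \<sigma> i \<in> {1..n} \<longleftrightarrow> i \<in> {1..n}" for i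
    using permutes_in_image[OF permutes_inv[OF perm]] by auto
  have inv_eq: "inv \<sigma> d = i \<longleftrightarrow> d = \<sigma> i" for d i
    using inverses by metis
  have right: "move_to_top c \<sigma> (?g d) = d" for d
    using range[of c] c by (auto simp: move_to_top_def inverses inv_eq split: if_splits)
  have left: "?g (move_to_top c \<sigma> i) = i" for i
    using range[of c] c by (auto simp: move_to_top_def inverses inv_eq split: if_splits)
  show "inv (move_to_top c \<sigma>) = ?g"
    using left right by (rule inv_equality)
  \<comment> \<open>Position 0 fails \<open>2 \<le> i\<close>, and a position beyond
    \<open>n\<close> exceeds \<open>inv \<sigma> c\<close>, so neither is shifted.\<close>
  have "move_to_top c \<sigma> i = i" if "i \<notin> {1..n}" for i
    using that range[of c] c permutes_not_in[OF perm that] by (auto simp: move_to_top_def)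
  moreover have "\<exists>!i. move_to_top c \<sigma> i = d" for d
    using left right by metis
  ultimately show "move_to_top c \<sigma> permutes {1..n}"
    unfolding permutes_def by blast
qed

text \<open>Card \<open>c\<close> lands at position 1 and all other cards at position 2 or below.
  Cards other than \<open>c\<close> keep their order, since those above the old place of
  \<open>c\<close> move down at most as far as that place.\<close>

lemma inv_move_to_top_less_iff:
  assumes perm: "\<sigma> permutes {1..n}" and c: "c \<in> {1..n}" and ab: "(a, b) \<in> card_pairs n"
  shows "inv (move_to_top c \<sigma>) b < inv (move_to_top c \<sigma>) a \<longleftrightarrow>
    (if c = b then True else if c = a then False else inv \<sigma> b < inv \<sigma> a)"
proof -
  have "inv \<sigma> d \<ge> 1" if "d \<in> {1..n}" for d
    using permutes_in_image[OF permutes_inv[OF perm], of d] that by auto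
  moreover have "inv \<sigma> d \<noteq> inv \<sigma> e" if "d \<noteq> e" for d e
    using that permutes_inverses[OF perm] by metis
  moreover have "a \<in> {1..n}" "b \<in> {1..n}" "a \<noteq> b"
    using ab by (auto simp: card_pairs_def)
  \<comment> \<open>Distinctness from the position of \<open>c\<close> rules out a tie between a
    shifted card and an unshifted one; what remains is arithmetic on positions.\<close>
  ultimately have "1 \<le> inv \<sigma> a" "1 \<le> inv \<sigma> b" "inv \<sigma> a \<noteq> inv \<sigma> b" "a \<noteq> b"
    "c \<noteq> a \<Longrightarrow> inv \<sigma> c \<noteq> inv \<sigma> a" "c \<noteq> b \<Longrightarrow> inv \<sigma> c \<noteq> inv \<sigma> b"
    by blast+
  then show ?thesis
    unfolding inv_move_to_top[OF perm c] by auto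
qed

text \<open>Exactly two of the \<open>n\<close> choices of \<open>c\<close> decide a given pair, one
  in each direction. The factor \<open>real n - 2\<close> is a real difference: it is negative for
  \<open>n < 2\<close>, but then there are no pairs.\<close>

lemma sum_inversions_move_to_top:
  assumes perm: "\<sigma> permutes {1..n}"
  shows "(\<Sum>c=1..n. real (inversions n (move_to_top c \<sigma>))) =
    real (n choose 2) + (real n - 2) * real (inversions n \<sigma>)"
proof -
  have pair: "(\<Sum>c=1..n. of_bool (inv (move_to_top c \<sigma>) b < inv (move_to_top c \<sigma>) a)) =
      1 + (real n - 2) * of_bool (inv \<sigma> b < inv \<sigma> a)" if ab: "(a, b) \<in> card_pairs n" for a b
  proof -
    have *: "a \<in> {1..n}" "b \<in> {1..n} - {a}"
      using ab by (auto simp: card_pairs_def)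
    let ?x = "of_bool (inv \<sigma> b < inv \<sigma> a) :: real"
    let ?f = "\<lambda>c. if c = b then 1 else if c = a then 0 else ?x"
    have "(\<Sum>c=1..n. of_bool (inv (move_to_top c \<sigma>) b < inv (move_to_top c \<sigma>) a)) = sum ?f {1..n}"
      by (intro sum.cong refl) (simp add: inv_move_to_top_less_iff[OF perm _ ab])
    also have "\<dots> = ?f a + (?f b + sum ?f ({1..n} - {a} - {b}))"
      using *(1) *(2)
      by (simp only: sum.remove[of _ a ?f] sum.remove[of _ b ?f] finite_atLeastAtMost finite_Diff)
    also have "sum ?f ({1..n} - {a} - {b}) = (\<Sum>c\<in>{1..n} - {a} - {b}. ?x)"
      by (rule sum.cong) auto
    \<comment> \<open>The distinct cards \<open>a\<close> and \<open>b\<close> force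
      \<open>n \<ge> 2\<close>, so the cardinality \<open>n - 2\<close> is not truncated.\<close>
    also have "\<dots> = (real n - 2) * ?x"
      using * by (auto simp: card_Diff_singleton of_nat_diff)
    also have "?f a + (?f b + (real n - 2) * ?x) = 1 + (real n - 2) * ?x"
      using * by simp
    finally show ?thesis .
  qed
  have "(\<Sum>c=1..n. real (inversions n (move_to_top c \<sigma>))) =
      (\<Sum>c=1..n. \<Sum>(a, b)\<in>card_pairs n.
        of_bool (inv (move_to_top c \<sigma>) b < inv (move_to_top c \<sigma>) a))"
    by (intro sum.cong refl inversions_eq_sum_card_pairs permutes_move_to_top[OF perm])
  also have "\<dots> = (\<Sum>(a, b)\<in>card_pairs n. 1 + (real n - 2) * of_bool (inv \<sigma> b < inv \<sigma> a))"
    by (subst sum.swap) (intro sum.cong refl, clarify, simp only: prod.case pair)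
  also have "\<dots> = real (n choose 2) + (real n - 2) * real (inversions n \<sigma>)"
    by (simp add: case_prod_unfold sum.distrib card_card_pairs sum_distrib_left
        inversions_eq_sum_card_pairs[OF perm])
  finally show ?thesis .
qed

lemma expectation_inversions_random_to_top:
  assumes "n \<ge> 1" "\<sigma> permutes {1..n}"
  shows "measure_pmf.expectation (random_to_top n \<sigma>) (\<lambda>\<tau>. real (inversions n \<tau>)) =
    (real (n choose 2) + (real n - 2) * real (inversions n \<sigma>)) / real n"
  using assms by (simp add: random_to_top_def integral_pmf_of_set sum_inversions_move_to_top del: One_nat_def)

lemma set_pmf_random_to_top:
  assumes "n \<ge> 1" "\<sigma> permutes {1..n}"
  shows "set_pmf (random_to_top n \<sigma>) \<subseteq> {\<tau>. \<tau> permutes {1..n}}"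
  using assms permutes_move_to_top by (auto simp: random_to_top_def)

text \<open>Confines the walk to a finite set of decks, on which the one-shuffle formula applies and
  expectations are finite sums.\<close>

lemma set_pmf_iterated_random_to_top:
  assumes "n \<ge> 1"
  shows "set_pmf (iterated_random_to_top n r) \<subseteq> {\<sigma>. \<sigma> permutes {1..n}}"
  by (induction r) (use set_pmf_random_to_top[OF assms] in \<open>auto simp: permutes_id\<close>)

lemma inversions_id: "inversions n id = 0"
proof -
  have "{(i, j). 1 \<le> i \<and> i < j \<and> j \<le> n \<and> id i > id j} = {}"
    by auto
  then show ?thesis
    unfolding inversions_def by (simp only: card.empty)
qed

text \<open>Condition on the deck after \<open>r\<close> shuffles: the conditional expectation is
  affine in its inversion count, so linearity passes it through the outer expectation.\<close>

lemma expectation_inversions_Suc: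
  assumes n: "n \<ge> 1"
  shows "measure_pmf.expectation (iterated_random_to_top n (Suc r)) (\<lambda>\<sigma>. real (inversions n \<sigma>)) =
    (real (n choose 2) + (real n - 2) *
      measure_pmf.expectation (iterated_random_to_top n r) (\<lambda>\<sigma>. real (inversions n \<sigma>))) / real n"
proof -
  let ?S = "{\<sigma>. \<sigma> permutes {1..n}}" and ?p = "iterated_random_to_top n r"
  have fin: "finite ?S"
    by (simp add: finite_permutations)
  note supp = set_pmf_iterated_random_to_top[OF n, of r]
  have int: "integrable (measure_pmf ?p) f" for f :: "(nat \<Rightarrow> nat) \<Rightarrow> real"
    by (rule integrable_measure_pmf_finite[OF finite_subset[OF supp fin]])
  \<comment> \<open>Total expectation, summed over all permutations instead of the support, as the
    others have weight 0.\<close>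
  have "measure_pmf.expectation (iterated_random_to_top n (Suc r)) (\<lambda>\<sigma>. real (inversions n \<sigma>)) =
      (\<Sum>\<sigma>\<in>?S. pmf ?p \<sigma> *\<^sub>R
        measure_pmf.expectation (random_to_top n \<sigma>) (\<lambda>\<tau>. real (inversions n \<tau>)))"
    unfolding iterated_random_to_top.simps
    by (rule pmf_expectation_bind[OF fin _ supp])
       (use finite_subset[OF set_pmf_random_to_top[OF n] fin] in auto)
  also have "\<dots> = (\<Sum>\<sigma>\<in>?S. pmf ?p \<sigma> *\<^sub>R
      ((real (n choose 2) + (real n - 2) * real (inversions n \<sigma>)) / real n))"
    by (intro sum.cong refl) (simp add: expectation_inversions_random_to_top[OF n])
  also have "\<dots> = measure_pmf.expectation ?p
      (\<lambda>\<sigma>. (real (n choose 2) + (real n - 2) * real (inversions n \<sigma>)) / real n)"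
    by (rule integral_measure_pmf[OF fin, symmetric]) (use supp in auto)
  also have "\<dots> = (real (n choose 2) + (real n - 2) *
      measure_pmf.expectation ?p (\<lambda>\<sigma>. real (inversions n \<sigma>))) / real n"
    by (simp add: int[of "\<lambda>\<sigma>. real (inversions n \<sigma>)"])
  finally show ?thesis .
qed

theorem proposition7p1:
  fixes n r :: nat
  assumes "n \<ge> 1" and "r \<ge> 1"
  shows "measure_pmf.expectation (iterated_random_to_top n r) (\<lambda>\<sigma>. real (inversions n \<sigma>))
           = real (n choose 2) / 2 * (1 - ((real n - 2) / real n) ^ r)"
\<comment> \<open>The induction starts at the unshuffled deck, where both sides are 0.\<close>
proof (induction r)
  case 0
  then show ?case by (simp add: inversions_id)
next
  case (Suc r)
  \<comment> \<open>With \<open>q = (real n - 2) / real n\<close> one has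
    \<open>1 / real n = (1 - q) / 2\<close>, so the recursion multiplies the distance to the fixed
    point by \<open>q\<close>.\<close>
  show ?case
    unfolding expectation_inversions_Suc[OF assms(1)] Suc
    using assms(1) by (simp add: field_simps)
qed

end
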